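(* For every connected graph $G$ and every positive integer $k$ with $k\equiv 3 \pmod 4$, $$\gamma_{\rm sp}(S_k(G)) = \begin{cases} \frac{k+1}{2}\, m(G)+1, & \text{if } G \text{ is a tree},\\[2pt] \frac{k+1}{2}\, m(G), & \text{otherwise}.\end{cases}$$
   Context: All graphs are finite, simple and undirected. $m(G)$ denotes the number of edges of $G$. For an integer $k\ge 1$, the $k$-subdivision $S_k(G)$ of $G$ is the graph obtained from $G$ by replacing each edge with a disjoint path of length $k+1$, that is, by subdividing each edge exactly $k$ times. For $D\subseteq V(G)$ write $\overline{D}=V(G)\setminus D$, and let $N_G(v)$ be the open neighborhood of $v$. A set $D\subseteq V(G)$ is a dominating set if every vertex of $\overline{D}$ has a neighbor in $D$. A dominating set $D$ is a super dominating set if for every $x\in\overline{D}$ there exists $y\in D$ such that $N_G(y)\cap\overline{D}=\{x\}$. The super domination number $\gamma_{\rm sp}(G)$ is the minimum cardinality of a super dominating set of $G$. *)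

theory Defs
  imports Complex_Main "Graph_Theory.Graph_Theory"
begin

text \<open>
  A finite simple undirected graph is a \<^locale>\<open>pair_graph\<close>, i.e. a finite, loop-free, symmetric
  set of vertex pairs: each undirected edge contributes its two arcs.
\<close>

definition num_edges :: "'a pair_pre_digraph \<Rightarrow> nat" where
  "num_edges G = card ((\<lambda>(u, v). {u, v}) ` parcs G)"

text \<open>
  In a symmetric digraph the two arcs of an edge already form a \<^const>\<open>pre_digraph.cycle\<close> of
  length 2, so the library's constant \<^const>\<open>tree\<close> does not describe undirected trees.
  The cycles of the undirected graph are those of length at least 3.
\<close>

definition undirected_tree :: "'a pair_pre_digraph \<Rightarrow> bool" where
  "undirected_tree G \<longleftrightarrow> Digraph_Component.connected (with_proj G) \<and>
     \<not> (\<exists>p. pre_digraph.cycle (with_proj G) p \<and> 3 \<le> length p)"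

text \<open>
  \<open>subdiv_point k u v i\<close> is the vertex at distance \<open>i\<close> from \<open>u\<close> on the path of length \<open>k + 1\<close> that
  replaces the edge \<open>uv\<close>. An inner vertex is named by its two descriptions, one for each direction
  of the edge, so that no orientation of the edges has to be chosen.
\<close>

definition subdiv_point :: "nat \<Rightarrow> 'a \<Rightarrow> 'a \<Rightarrow> nat \<Rightarrow> 'a + ('a \<times> 'a \<times> nat) set" where
  "subdiv_point k u v i =
     (if i = 0 then Inl u else if i = k + 1 then Inl v
      else Inr {(u, v, i), (v, u, k + 1 - i)})"

definition k_subdivision ::
    "nat \<Rightarrow> 'a pair_pre_digraph \<Rightarrow> ('a + ('a \<times> 'a \<times> nat) set) pair_pre_digraph" where
  "k_subdivision k G =
     \<lparr> pverts = Inl ` pverts G \<union> {subdiv_point k u v i | u v i. (u, v) \<in> parcs G \<and> i \<in> {1..k}},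
       parcs = {(subdiv_point k u v i, subdiv_point k u v (i + 1)) | u v i.
                  (u, v) \<in> parcs G \<and> i \<le> k} \<rparr>"

definition open_nbhd :: "'a pair_pre_digraph \<Rightarrow> 'a \<Rightarrow> 'a set" where
  "open_nbhd G v = {w. (v, w) \<in> parcs G}"

definition dominating_set :: "'a pair_pre_digraph \<Rightarrow> 'a set \<Rightarrow> bool" where
  "dominating_set G D \<longleftrightarrow> D \<subseteq> pverts G \<and> (\<forall>x \<in> pverts G - D. open_nbhd G x \<inter> D \<noteq> {})"

definition super_dominating_set :: "'a pair_pre_digraph \<Rightarrow> 'a set \<Rightarrow> bool" where
  "super_dominating_set G D \<longleftrightarrow> dominating_set G D \<and>
     (\<forall>x \<in> pverts G - D. \<exists>y \<in> D. open_nbhd G y \<inter> (pverts G - D) = {x})"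

definition super_domination_number :: "'a pair_pre_digraph \<Rightarrow> nat" where
  "super_domination_number G = Min (card ` {D. super_dominating_set G D})"

text \<open>The minimum is taken over a finite nonempty set.\<close>

lemma super_domination_number_attained:
  assumes "finite (pverts G)"
  shows "\<exists>D. super_dominating_set G D \<and> card D = super_domination_number G"
    and "super_dominating_set G D \<Longrightarrow> super_domination_number G \<le> card D"
proof -
  have "{D. super_dominating_set G D} \<subseteq> Pow (pverts G)"
    by (auto simp: super_dominating_set_def dominating_set_def)
  then have fin: "finite (card ` {D. super_dominating_set G D})"
    using assms by (meson finite_Pow_iff finite_imageI finite_subset)
  have "super_dominating_set G (pverts G)"
    by (simp add: super_dominating_set_def dominating_set_def)
  then have "card ` {D. super_dominating_set G D} \<noteq> {}" by blast
  from Min_in[OF fin this]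
  show "\<exists>D. super_dominating_set G D \<and> card D = super_domination_number G"
    unfolding super_domination_number_def by auto
  show "super_dominating_set G D \<Longrightarrow> super_domination_number G \<le> card D"
    unfolding super_domination_number_def using fin by (auto intro: Min_le)
qed

lemma subdiv_point_reverse:
  "i \<le> k + 1 \<Longrightarrow> subdiv_point k v u (k + 1 - i) = subdiv_point k u v i"
  by (auto simp: subdiv_point_def)

lemma subdiv_point_inner_eq_iff:
  assumes "u \<noteq> v" "i \<in> {1..k}" "j \<in> {1..k}"
  shows "subdiv_point k u v i = subdiv_point k u' v' j \<longleftrightarrow>
           u' = u \<and> v' = v \<and> j = i \<or> u' = v \<and> v' = u \<and> j = k + 1 - i"
  using assms by (auto simp: subdiv_point_def doubleton_eq_iff)

lemma pair_graph_k_subdivision: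
  assumes "pair_graph G"
  shows "pair_graph (k_subdivision k G)"
proof -
  interpret pair_graph G by fact
  let ?p = "subdiv_point k" and ?H = "k_subdivision k G"
  have point_in: "?p u v i \<in> pverts ?H" if "(u, v) \<in> parcs G" "i \<le> k + 1" for u v i
  proof (cases "i \<in> {1..k}")
    case True
    with that show ?thesis by (auto simp: k_subdivision_def)
  next
    case False
    with that have "i = 0 \<or> i = k + 1" by auto
    then show ?thesis
      using in_arcsD1[OF that(1)] in_arcsD2[OF that(1)]
      by (auto simp: k_subdivision_def subdiv_point_def)
  qed
  have "pverts ?H \<subseteq> Inl ` pverts G \<union> (\<lambda>((u, v), i). ?p u v i) ` (parcs G \<times> {1..k})"
    by (force simp: k_subdivision_def)
  then have finite_verts: "finite (pverts ?H)"
    by (rule finite_subset) (simp add: pair_finite_verts pair_finite_arcs)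
  have "parcs ?H \<subseteq> (\<lambda>((u, v), i). (?p u v i, ?p u v (i + 1))) ` (parcs G \<times> {..k})"
    by (force simp: k_subdivision_def)
  then have finite_arcs: "finite (parcs ?H)"
    by (rule finite_subset) (simp add: pair_finite_arcs)
  have no_loop: "?p u v i \<noteq> ?p u v (i + 1)" if "(u, v) \<in> parcs G" "i \<le> k" for u v i
    using that no_loops'[OF that(1)] by (auto simp: subdiv_point_def doubleton_eq_iff)
  have arc_in: "(?p u v i, ?p u v (i + 1)) \<in> parcs ?H" if "(u, v) \<in> parcs G" "i \<le> k" for u v i
    using that by (auto simp: k_subdivision_def)
  have arcE: thesis
    if "e \<in> parcs ?H"
      "\<And>u v i. (u, v) \<in> parcs G \<Longrightarrow> i \<le> k \<Longrightarrow> e = (?p u v i, ?p u v (i + 1)) \<Longrightarrow> thesis"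
    for e thesis
    using that by (auto simp: k_subdivision_def)
  have sym: "(b, a) \<in> parcs ?H" if arc: "(a, b) \<in> parcs ?H" for a b
  proof -
    obtain u v i where uv: "(u, v) \<in> parcs G" "i \<le> k"
      and ab: "a = ?p u v i" "b = ?p u v (i + 1)"
      using arc by (auto simp: k_subdivision_def)
    have "b = ?p v u (k - i)" "a = ?p v u (k - i + 1)"
      using uv(2) subdiv_point_reverse[of "i + 1" k v u] subdiv_point_reverse[of i k v u]
      by (simp_all add: ab Suc_diff_le)
    moreover have "(?p v u (k - i), ?p v u (k - i + 1)) \<in> parcs ?H"
      using arcs_symmetric[OF uv(1)] by (intro arc_in) auto
    ultimately show ?thesis by simp
  qed
  show ?thesis
  proof
    show "fst e \<in> pverts ?H" if "e \<in> parcs ?H" for e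
      using that by (rule arcE) (simp add: point_in)
    show "snd e \<in> pverts ?H" if "e \<in> parcs ?H" for e
      using that by (rule arcE) (simp add: point_in)
    show "fst e \<noteq> snd e" if "e \<in> parcs ?H" for e
      using that by (rule arcE) (use no_loop in simp)
    show "symmetric (with_proj ?H)"
      using sym by (auto simp: symmetric_def intro: symI)
  qed (fact finite_verts finite_arcs)+
qed

end

theory Submission
  imports Defs
begin

text \<open>
  Write \<open>k = 4t + 3\<close>, let \<open>G\<close> have \<open>n\<close> vertices and \<open>m\<close> edges, and let \<open>X\<close> be the complement of a
  super dominating set \<open>D\<close> of the subdivision, which has \<open>n + km\<close> vertices. Private neighbours in \<open>D\<close>
  inject \<open>X\<close> into \<open>D\<close>; moreover each original vertex accounts for at most one element of \<open>X\<close> and each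
  subdivided edge for at most \<open>2t + 1\<close> others, so \<open>|X| \<le> n + (2t + 1)m\<close>. For trees, where \<open>n = m + 1\<close>,
  the bound \<open>2|D| \<ge> n + km\<close> is stronger by one. Conversely, if \<open>F\<close> selects at most one outgoing arc
  at each vertex and never both arcs of an edge, some \<open>X\<close> has \<open>(2t + 1)m + |F|\<close> elements. Orienting
  everything towards a root gives \<open>|F| = n - 1\<close>; orienting a cycle cyclically and everything else
  towards it gives \<open>|F| = n\<close>.
\<close>

section \<open>Orientations, and the vertices and neighbourhoods of the subdivision\<close>

text \<open>Choosing one arc per edge turns counting edges into counting arcs and leaves each inner
  vertex of the subdivision a single name.\<close>

definition orientation :: "('a \<times> 'a) set \<Rightarrow> ('a \<times> 'a) set \<Rightarrow> bool" where
  "orientation E A \<longleftrightarrow> E = A \<union> A\<inverse> \<and> A \<inter> A\<inverse> = {}"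

definition inner_points :: "nat \<Rightarrow> 'a \<times> 'a \<Rightarrow> ('a + ('a \<times> 'a \<times> nat) set) set" where
  "inner_points k e = subdiv_point k (fst e) (snd e) ` {1..k}"

lemma subdiv_point_0 [simp]: "subdiv_point k u v 0 = Inl u"
  by (simp add: subdiv_point_def)

lemma subdiv_point_end [simp]: "subdiv_point k u v (Suc k) = Inl v"
  by (simp add: subdiv_point_def)

lemma subdiv_point_neq_Inl: "i \<in> {1..k} \<Longrightarrow> subdiv_point k u v i \<noteq> Inl w"
  by (auto simp: subdiv_point_def)

text \<open>Counts the positions that the upper bound construction takes on every edge; position 1
  is left out because only selected arcs may use it. Each further block of four positions adds
  two.\<close>

lemma card_residues_1_2_mod_4:
  fixes t :: nat
  shows "card {i \<in> {2..4*t+3}. i mod 4 = 1 \<or> i mod 4 = 2} = 2 * t + 1"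
proof (induction t)
  case 0
  have "{i \<in> {2..4*0+3}. i mod 4 = 1 \<or> i mod 4 = 2} = {2::nat}"
    by (intro set_eqI) (simp, presburger)
  then show ?case by simp
next
  case (Suc t)
  let ?B = "\<lambda>t. {i \<in> {2..4*t+3::nat}. i mod 4 = 1 \<or> i mod 4 = 2}"
  have "?B (Suc t) = ?B t \<union> {4*t+5, 4*t+6}"
    by (intro set_eqI) (simp, presburger)
  moreover have "?B t \<inter> {4*t+5, 4*t+6} = {}" by auto
  ultimately have "card (?B (Suc t)) = card (?B t) + card {4*t+5, 4*t+6::nat}"
    by (simp add: card_Un_disjoint)
  then show ?case using Suc by simp
qed

lemma inner_points_swap:
  fixes u v :: 'a
  shows "inner_points k (v, u) = inner_points k (u, v)"
proof -
  have "inner_points k (v, u) \<subseteq> inner_points k (u, v)" for u v :: 'a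
    unfolding inner_points_def fst_conv snd_conv
  proof (rule image_subsetI)
    fix i assume "i \<in> {1..k}"
    then have "subdiv_point k v u i = subdiv_point k u v (k + 1 - i)" "k + 1 - i \<in> {1..k}"
      using subdiv_point_reverse[of i k u v] by auto
    then show "subdiv_point k v u i \<in> subdiv_point k u v ` {1..k}"
      by (rule image_eqI)
  qed
  then show ?thesis by (intro equalityI)
qed

context pair_graph
begin

text \<open>Number the vertices injectively and direct every edge not covered by \<open>F\<close>
  upwards. The case \<open>F = {}\<close> shows that an orientation exists.\<close>

lemma orientation_extending:
  assumes "F \<subseteq> parcs G" "F \<inter> F\<inverse> = {}"
  obtains A where "orientation (parcs G) A" "F \<subseteq> A"
proof -
  obtain h :: "'a \<Rightarrow> nat" where h: "inj_on h (pverts G)"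
    using finite_imp_inj_to_nat_seg[OF pair_finite_verts] by blast
  let ?A = "F \<union> {(u, v) \<in> parcs G - F\<inverse>. h u < h v}"
  have "h u < h v \<or> h v < h u" if "(u, v) \<in> parcs G" for u v
    using that h no_loops'[OF that] in_arcsD1[OF that] in_arcsD2[OF that]
    by (metis inj_onD linorder_neqE_nat)
  then have "parcs G \<subseteq> ?A \<union> ?A\<inverse>"
    using arcs_symmetric by blast
  moreover have "?A \<union> ?A\<inverse> \<subseteq> parcs G"
    using assms(1) arcs_symmetric by auto
  moreover have "?A \<inter> ?A\<inverse> = {}"
    using assms(2) by auto
  ultimately show ?thesis using that[of ?A] by (auto simp only: orientation_def)
qed

lemma card_orientation:
  assumes "orientation (parcs G) A"
  shows "num_edges G = card A"
proof -
  from assms have E: "parcs G = A \<union> A\<inverse>" and disj: "A \<inter> A\<inverse> = {}"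
    by (simp_all only: orientation_def)
  have "(\<lambda>(u, v). {u, v}) ` A\<inverse> = (\<lambda>(u, v). {u, v}) ` A"
    by (auto simp: image_iff insert_commute)
  then have "(\<lambda>(u, v). {u, v}) ` parcs G = (\<lambda>(u, v). {u, v}) ` A"
    by (simp add: E image_Un)
  moreover have "inj_on (\<lambda>(u, v). {u, v}) A"
    using disj by (auto simp: inj_on_def doubleton_eq_iff)
  ultimately show ?thesis by (simp add: num_edges_def card_image)
qed

text \<open>The two names of an inner vertex come from opposite arcs, and \<open>A\<close> contains
  only one of these.\<close>

lemma inj_on_oriented_points:
  assumes "orientation (parcs G) A"
  shows "inj_on (\<lambda>((u, v), i). subdiv_point k u v i) (A \<times> {1..k})"
    (is "inj_on ?f _")
proof (rule inj_onI)
  fix x y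
  assume "x \<in> A \<times> {1..k}" "y \<in> A \<times> {1..k}"
    "?f x = ?f y"
  then obtain u v i u' v' j where xy: "x = ((u, v), i)" "y = ((u', v'), j)"
    and *: "(u, v) \<in> A" "(u', v') \<in> A" "i \<in> {1..k}" "j \<in> {1..k}"
    "subdiv_point k u v i = subdiv_point k u' v' j"
    by (cases x, cases y) auto
  have "u \<noteq> v" using * assms no_loops' by (auto simp: orientation_def)
  from * subdiv_point_inner_eq_iff[OF this, of i k j u' v'] assms
  show "x = y" unfolding xy by (auto simp: orientation_def)
qed

lemma verts_k_subdivision:
  assumes "orientation (parcs G) A"
  shows "pverts (k_subdivision k G) = Inl ` pverts G \<union> (\<Union>e\<in>A. inner_points k e)"
proof -
  have "{subdiv_point k u v i | u v i. (u, v) \<in> parcs G \<and> i \<in> {1..k}}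
      = (\<Union>e\<in>parcs G. inner_points k e)"
    by (force simp: inner_points_def)
  also have "\<dots> = (\<Union>e\<in>A. inner_points k e) \<union> (\<Union>e\<in>A\<inverse>. inner_points k e)"
    using assms by (simp add: orientation_def)
  also have "(\<Union>e\<in>A\<inverse>. inner_points k e) = (\<Union>e\<in>A. inner_points k e)"
    using inner_points_swap by fastforce
  finally show ?thesis by (simp add: k_subdivision_def)
qed

lemma finite_orientation: "orientation (parcs G) A \<Longrightarrow> finite A"
  using pair_finite_arcs by (simp add: orientation_def)

lemma card_inner_points:
  assumes "orientation (parcs G) A" "e \<in> A"
  shows "card (inner_points k e) = k"
proof -
  have "inj_on (\<lambda>i. subdiv_point k (fst e) (snd e) i) {1..k}"
  proof (rule inj_onI)
    fix i j
    assume "i \<in> {1..k}" "j \<in> {1..k}"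
      "subdiv_point k (fst e) (snd e) i = subdiv_point k (fst e) (snd e) j"
    then show "i = j"
      using inj_onD[OF inj_on_oriented_points[OF assms(1), of k], of "(e, i)" "(e, j)"] assms(2)
      by (simp add: case_prod_beta)
  qed
  then show ?thesis by (simp add: inner_points_def card_image)
qed

lemma card_Union_inner_points:
  assumes "orientation (parcs G) A"
  shows "card (\<Union>e\<in>A. inner_points k e) = k * num_edges G"
proof -
  have "(\<Union>e\<in>A. inner_points k e) = (\<lambda>((u, v), i). subdiv_point k u v i) ` (A \<times> {1..k})"
    by (force simp: inner_points_def)
  then show ?thesis
    using inj_on_oriented_points[OF assms, of k] card_orientation[OF assms]
    by (simp add: card_image card_cartesian_product)
qed

lemma Inl_inner_points_disjoint: "Inl ` S \<inter> inner_points k e = {}"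
  by (force simp: inner_points_def subdiv_point_def)

lemma card_verts_k_subdivision:
  "card (pverts (k_subdivision k G)) = card (pverts G) + k * num_edges G"
proof -
  obtain A where A: "orientation (parcs G) A"
    using orientation_extending[of "{}"] by auto
  have fin: "finite (\<Union>e\<in>A. inner_points k e)"
    using finite_orientation[OF A] by (simp add: inner_points_def)
  have "Inl ` pverts G \<inter> (\<Union>e\<in>A. inner_points k e) = {}"
    using Inl_inner_points_disjoint by fast
  then show ?thesis
    unfolding verts_k_subdivision[OF A]
    by (simp add: card_Un_disjoint fin card_image card_Union_inner_points[OF A]
        pair_finite_verts)
qed

text \<open>An arc leaving the point uses one of its two names: the given one leads to position
  \<open>i + 1\<close>, the reversed one to position \<open>i - 1\<close>.\<close>

lemma open_nbhd_inner:
  assumes "(u, v) \<in> parcs G" "i \<in> {1..k}"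
  shows "open_nbhd (k_subdivision k G) (subdiv_point k u v i)
    = {subdiv_point k u v (i - 1), subdiv_point k u v (i + 1)}" (is "?N = ?R")
proof
  have "u \<noteq> v" using no_loops'[OF assms(1)] .
  show "?R \<subseteq> ?N"
  proof -
    interpret H: pair_graph "k_subdivision k G"
      by (rule pair_graph_k_subdivision[OF pair_graph])
    have "(subdiv_point k u v i, subdiv_point k u v (i + 1)) \<in> parcs (k_subdivision k G)"
      using assms by (auto simp: k_subdivision_def)
    moreover have "(subdiv_point k u v j, subdiv_point k u v (j + 1)) \<in> parcs (k_subdivision k G)"
      if "j \<le> k" for j
      using assms that by (auto simp: k_subdivision_def)
    from H.arcs_symmetric[OF this[of "i - 1"]] assms(2)
    have "(subdiv_point k u v i, subdiv_point k u v (i - 1)) \<in> parcs (k_subdivision k G)"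
      by auto
    ultimately show ?thesis by (simp add: open_nbhd_def)
  qed
  show "?N \<subseteq> ?R"
  proof
    fix w assume "w \<in> ?N"
    then obtain u' v' j where j: "(u', v') \<in> parcs G" "j \<le> k"
      "subdiv_point k u v i = subdiv_point k u' v' j" "w = subdiv_point k u' v' (j + 1)"
      by (auto simp: open_nbhd_def k_subdivision_def)
    have "j \<noteq> 0" using j(3) assms(2) subdiv_point_neq_Inl[of i k u v u'] by (cases j) auto
    then have "j \<in> {1..k}" using j(2) by simp
    with j(3) subdiv_point_inner_eq_iff[OF \<open>u \<noteq> v\<close> assms(2), of j u' v']
    consider "u' = u" "v' = v" "j = i" | "u' = v" "v' = u" "j = k + 1 - i" by auto
    then show "w \<in> ?R"
    proof cases
      case 1
      then show ?thesis using j(4) by simp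
    next
      case 2
      then have "w = subdiv_point k v u (k + 1 - (i - 1))" using j(4) assms(2) by (simp add: Suc_diff_le)
      also have "\<dots> = subdiv_point k u v (i - 1)"
        using assms(2) by (intro subdiv_point_reverse) auto
      finally show ?thesis by simp
    qed
  qed
qed

lemma open_nbhd_Inl:
  assumes "k > 0"
  shows "open_nbhd (k_subdivision k G) (Inl u) = {subdiv_point k u v 1 | v. (u, v) \<in> parcs G}"
proof -
  have start: "j = 0 \<and> a = u" if "Inl u = subdiv_point k a b j" "j \<le> k" for a b j
    using that subdiv_point_neq_Inl[of j k a b u] by (cases "j = 0") auto
  have "open_nbhd (k_subdivision k G) (Inl u) \<subseteq> {subdiv_point k u v 1 | v. (u, v) \<in> parcs G}"
    using start by (fastforce simp: open_nbhd_def k_subdivision_def)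
  moreover have "(Inl u, subdiv_point k u v 1) \<in> parcs (k_subdivision k G)"
    if "(u, v) \<in> parcs G" for v
  proof -
    have "(subdiv_point k u v 0, subdiv_point k u v (0 + 1)) \<in> parcs (k_subdivision k G)"
      unfolding k_subdivision_def using that by force
    then show ?thesis by simp
  qed
  ultimately show ?thesis by (auto simp: open_nbhd_def)
qed

lemma finite_verts_k_subdivision: "finite (pverts (k_subdivision k G))"
proof -
  interpret H: pair_graph "k_subdivision k G"
    by (rule pair_graph_k_subdivision[OF pair_graph])
  show ?thesis by (rule H.pair_finite_verts)
qed

section \<open>Private neighbours and lower bounds for super dominating sets\<close>

text \<open>Domination comes for free: by symmetry, the private neighbour of \<open>x\<close> is
  itself a neighbour of \<open>x\<close> outside \<open>X\<close>.\<close>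

lemma super_dominating_setI:
  assumes "X \<subseteq> pverts G"
    and "\<And>x. x \<in> X \<Longrightarrow> \<exists>y \<in> pverts G - X. open_nbhd G y \<inter> X = {x}"
  shows "super_dominating_set G (pverts G - X)"
proof -
  have X: "pverts G - (pverts G - X) = X" using assms(1) by blast
  have "open_nbhd G x \<inter> (pverts G - X) \<noteq> {}" if x: "x \<in> X" for x
  proof -
    obtain y where y: "y \<in> pverts G - X" "open_nbhd G y \<inter> X = {x}" using assms(2)[OF x] by blast
    then have "(y, x) \<in> parcs G" by (auto simp: open_nbhd_def)
    then have "(x, y) \<in> parcs G" by (rule arcs_symmetric)
    then show ?thesis using y(1) by (auto simp: open_nbhd_def)
  qed
  then show ?thesis
    unfolding super_dominating_set_def dominating_set_def X using assms(2) by simp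
qed

end

lemma super_dominating_setE:
  assumes "super_dominating_set G D"
  obtains g where "g ` (pverts G - D) \<subseteq> D" "inj_on g (pverts G - D)"
    "\<And>x. x \<in> pverts G - D \<Longrightarrow> open_nbhd G (g x) \<inter> (pverts G - D) = {x}"
proof -
  from assms have "\<forall>x \<in> pverts G - D. \<exists>y. y \<in> D \<and> open_nbhd G y \<inter> (pverts G - D) = {x}"
    by (auto simp: super_dominating_set_def)
  then obtain g where g: "\<And>x. x \<in> pverts G - D \<Longrightarrow> g x \<in> D"
    "\<And>x. x \<in> pverts G - D \<Longrightarrow> open_nbhd G (g x) \<inter> (pverts G - D) = {x}"
    by metis
  have "inj_on g (pverts G - D)"
    by (rule inj_onI) (metis g(2) singleton_inject)
  with g show ?thesis by (intro that[of g]) auto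
qed

text \<open>Private neighbours inject the complement of \<open>D\<close> into \<open>D\<close>. This
  is the bound used for trees.\<close>

lemma card_verts_le_twice_super_dominating:
  assumes "finite (pverts G)" "super_dominating_set G D"
  shows "card (pverts G) \<le> 2 * card D"
proof -
  have D: "D \<subseteq> pverts G" using assms(2) by (simp add: super_dominating_set_def dominating_set_def)
  then have fin: "finite D" using assms(1) finite_subset by blast
  obtain g where "g ` (pverts G - D) \<subseteq> D" "inj_on g (pverts G - D)"
    using super_dominating_setE[OF assms(2)] by metis
  then have "card (pverts G - D) \<le> card D" using card_inj_on_le fin by blast
  then show ?thesis using card_Diff_subset[OF fin D] by simp
qed

context pair_graph
begin

text \<open>
  Charge a vertex outside \<open>D\<close> to an original vertex: to itself if it is one, and otherwise to its
  private neighbour if that is one. The vertices left over lie, together with their private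
  neighbours, inside a single subdivided edge.
\<close>

lemma super_dominating_set_k_subdivision_ge:
  assumes "k = 2 * s + 1" and sd: "super_dominating_set (k_subdivision k G) D"
  shows "(s + 1) * num_edges G \<le> card D"
proof -
  let ?H = "k_subdivision k G"
  let ?V = "Inl ` pverts G :: ('a + ('a \<times> 'a \<times> nat) set) set"
  define X where "X = pverts ?H - D"
  obtain A where A: "orientation (parcs G) A"
    using orientation_extending[of "{}"] by auto
  obtain g where g: "g ` X \<subseteq> D" "inj_on g X" "\<And>x. x \<in> X \<Longrightarrow> open_nbhd ?H (g x) \<inter> X = {x}"
    using super_dominating_setE[OF sd] unfolding X_def by metis
  have DH: "D \<subseteq> pverts ?H" using sd by (simp add: super_dominating_set_def dominating_set_def)
  have finX: "finite X" using finite_verts_k_subdivision by (simp add: X_def)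
  have finD: "finite D" using finite_subset[OF DH finite_verts_k_subdivision] .
  have AE: "A \<subseteq> parcs G" using A by (auto simp: orientation_def)

  define X0 where "X0 = X \<inter> ?V"
  define X1 where "X1 = {x \<in> X - ?V. g x \<in> ?V}"
  define X2 where "X2 = {x \<in> X - ?V. g x \<notin> ?V}"
  have X: "X = X0 \<union> X1 \<union> X2" by (auto simp: X0_def X1_def X2_def)
  \<comment> \<open>No original vertex is charged twice: \<open>X0\<close> lies outside
    \<open>D\<close>, while \<open>g\<close> is injective and maps \<open>X1\<close> into
    \<open>D\<close>.\<close>
  have "card X0 + card X1 = card (X0 \<union> g ` X1)"
  proof -
    have "inj_on g X1" by (rule inj_on_subset[OF g(2)]) (auto simp: X1_def)
    moreover have "X0 \<inter> g ` X1 = {}" using g(1) by (auto simp: X0_def X1_def X_def)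
    moreover have "finite X0" "finite X1" using finX by (auto simp: X0_def X1_def)
    ultimately show ?thesis by (simp add: card_Un_disjoint card_image)
  qed
  also have "\<dots> \<le> card ?V"
    by (rule card_mono) (auto simp: pair_finite_verts X0_def X1_def)
  also have "\<dots> = card (pverts G)" by (simp add: card_image)
  finally have X01: "card X0 + card X1 \<le> card (pverts G)" .

  \<comment> \<open>These vertices and their private neighbours are disjoint sets of equal size
    among the \<open>2 * s + 1\<close> inner points of \<open>e\<close>.\<close>
  have inner_edge: "card (X2 \<inter> inner_points k e) \<le> s" if e: "e \<in> A" for e
  proof -
    let ?P = "inner_points k e"
    obtain u v where uv: "e = (u, v)" by (cases e)
    \<comment> \<open>As \<open>g x\<close> is an inner point, its neighbours lie along its own
      edge; \<open>x\<close> is an inner one of them, so by unique naming that edge is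
      \<open>e\<close>.\<close>
    have stay: "g x \<in> ?P" if x: "x \<in> X2 \<inter> ?P" for x
    proof -
      have "x \<in> X" "g x \<notin> ?V" using x by (auto simp: X2_def)
      have "g x \<in> pverts ?H" using \<open>x \<in> X\<close> g(1) DH by auto
      then obtain e' where "e' \<in> A" "g x \<in> inner_points k e'"
        using \<open>g x \<notin> ?V\<close> verts_k_subdivision[OF A] by auto
      then obtain u' v' j where j: "(u', v') \<in> A" "e' = (u', v')" "j \<in> {1..k}" "g x = subdiv_point k u' v' j"
        by (cases e') (auto simp: inner_points_def)
      obtain i where i: "i \<in> {1..k}" "x = subdiv_point k u v i"
        using x by (auto simp: inner_points_def uv)
      have "x \<in> open_nbhd ?H (g x)" using g(3)[OF \<open>x \<in> X\<close>] by auto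
      then have "x = subdiv_point k u' v' (j - 1) \<or> x = subdiv_point k u' v' (j + 1)"
        using open_nbhd_inner[of u' v' j k] j AE by auto
      then obtain l where l: "x = subdiv_point k u' v' l" "l \<le> k + 1"
        using j(3) by (metis add_le_mono1 atLeastAtMost_iff diff_le_self le_add1 le_trans)
      have "x \<noteq> Inl w" for w using i subdiv_point_neq_Inl by metis
      then have "l \<noteq> 0" "l \<noteq> Suc k"
        using l(1) subdiv_point_0 subdiv_point_end by metis+
      then have "l \<in> {1..k}" using l(2) by auto
      then have "e = e'"
        using inj_onD[OF inj_on_oriented_points[OF A, of k], of "((u, v), i)" "((u', v'), l)"]
          i l(1) j(1,2) e uv by simp
      then show ?thesis using \<open>g x \<in> inner_points k e'\<close> by simp
    qed
    let ?Y = "X2 \<inter> ?P"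
    have "inj_on g ?Y" by (rule inj_on_subset[OF g(2)]) (auto simp: X2_def)
    moreover have "?Y \<inter> g ` ?Y = {}" using g(1) by (auto simp: X2_def X_def)
    moreover have "finite ?Y" using finX by (auto simp: X2_def)
    ultimately have "2 * card ?Y = card (?Y \<union> g ` ?Y)"
      by (simp add: card_Un_disjoint card_image)
    also have "\<dots> \<le> card ?P"
      by (rule card_mono) (use stay in \<open>auto simp: inner_points_def\<close>)
    also have "\<dots> = k" using card_inner_points[OF A e] .
    finally show ?thesis using assms(1) by simp
  qed
  have "X2 \<subseteq> (\<Union>e\<in>A. X2 \<inter> inner_points k e)"
    using verts_k_subdivision[OF A, of k] by (auto simp: X2_def X_def)
  then have "card X2 \<le> card (\<Union>e\<in>A. X2 \<inter> inner_points k e)"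
    by (intro card_mono) (use finX finite_orientation[OF A] in \<open>auto simp: X2_def\<close>)
  also have "\<dots> \<le> (\<Sum>e\<in>A. card (X2 \<inter> inner_points k e))"
    by (rule card_UN_le[OF finite_orientation[OF A]])
  also have "\<dots> \<le> card A * s" using sum_bounded_above[of A _ s] inner_edge by simp
  finally have X2: "card X2 \<le> num_edges G * s" using card_orientation[OF A] by simp

  \<comment> \<open>At most \<open>n + s * m\<close> of the \<open>n + (2 * s + 1) * m\<close>
    vertices lie in \<open>X\<close>, which leaves at least \<open>(s + 1) * m\<close> for
    \<open>D\<close>.\<close>
  have "card X \<le> card X0 + card X1 + card X2"
    unfolding X by (metis add_le_mono1 card_Un_le le_trans)
  moreover have "card X = card (pverts ?H) - card D"
    unfolding X_def using card_Diff_subset[OF finD DH] .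
  ultimately show ?thesis
    using X01 X2 card_verts_k_subdivision[of k] assms(1) by (simp add: algebra_simps)
qed

section \<open>Construction of small super dominating sets\<close>

text \<open>Each arc of \<open>F\<close> saves one vertex. Disjointness from the converse lets
  \<open>F\<close> extend to an orientation; single-valuedness keeps a tail from serving two arcs.
  The additive form avoids truncated subtraction.\<close>

lemma super_domination_number_k_subdivision_le:
  assumes k: "k = 4 * t + 3"
    and F: "F \<subseteq> parcs G" "F \<inter> F\<inverse> = {}" "single_valued F"
  shows "super_domination_number (k_subdivision k G) + (2 * t + 1) * num_edges G + card F
    \<le> card (pverts G) + k * num_edges G"
proof -
  let ?H = "k_subdivision k G"
  let ?f = "\<lambda>((u, v), i). subdiv_point k u v i"
  interpret H: pair_graph ?H by (rule pair_graph_k_subdivision[OF pair_graph])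
  obtain A where A: "orientation (parcs G) A" and FA: "F \<subseteq> A"
    using orientation_extending[OF F(1,2)] .
  have AE: "A \<subseteq> parcs G" using A by (auto simp: orientation_def)
  \<comment> \<open>Along each oriented edge, \<open>X\<close> takes the positions congruent to 1 or 2 modulo 4, but position 1
    only for arcs in \<open>F\<close>, since it needs the tail of the arc as its private neighbour.\<close>
  define B where "B = {i \<in> {2..4*t+3}. i mod 4 = 1 \<or> i mod 4 = 2}"
  define I where "I = A \<times> B \<union> F \<times> {1}"
  define X where "X = ?f ` I"
  have I: "I \<subseteq> A \<times> {1..k}" using FA k by (auto simp: I_def B_def)
  have inj: "inj_on ?f (A \<times> {1..k})" by (rule inj_on_oriented_points[OF A])
  have "A \<times> B \<inter> F \<times> {1} = {}" by (auto simp: B_def)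
  moreover have "finite F" "finite A" "finite B"
    using finite_subset[OF FA] finite_orientation[OF A] by (auto simp: B_def)
  ultimately have "card I = card A * card B + card F"
    by (simp add: I_def card_Un_disjoint card_cartesian_product)
  moreover have "card X = card I" unfolding X_def by (rule card_image[OF inj_on_subset[OF inj I]])
  ultimately have cardX: "card X = (2 * t + 1) * num_edges G + card F"
    using card_orientation[OF A] card_residues_1_2_mod_4[of t] by (simp add: B_def)
  have XH: "X \<subseteq> pverts ?H"
    unfolding X_def verts_k_subdivision[OF A] inner_points_def using I by fastforce
  have mem: "subdiv_point k u v i \<in> X \<longleftrightarrow> ((u, v), i) \<in> I" if "(u, v) \<in> A" "i \<in> {1..k}" for u v i
    using inj_on_image_mem_iff[OF inj, of "((u, v), i)" I] I that by (simp add: X_def)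
  have Inl: "Inl u \<notin> X" for u
    using I subdiv_point_neq_Inl[of _ k _ _ u] by (fastforce simp: X_def)
  have inH: "subdiv_point k u v i \<in> pverts ?H" if "(u, v) \<in> A" "i \<in> {1..k}" for u v i
    unfolding verts_k_subdivision[OF A] inner_points_def using that by fastforce

  have "\<exists>y \<in> pverts ?H - X. open_nbhd ?H y \<inter> X = {x}" if x: "x \<in> X" for x
  proof -
    obtain u v i where i: "((u, v), i) \<in> I" "x = subdiv_point k u v i"
      using x by (auto simp: X_def)
    then have uv: "(u, v) \<in> A" "(u, v) \<in> parcs G" and ik: "i \<in> {1..k}" using I AE by auto
    \<comment> \<open>The private neighbours are, in turn, the tail \<open>Inl u\<close>, the next
      point at \<open>i + 1\<close>, and the previous point at \<open>i - 1\<close>.\<close>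
    consider "i = 1" "(u, v) \<in> F" | "i mod 4 = 2" | "i mod 4 = 1" "i \<ge> 2"
      using i(1) by (auto simp: I_def B_def)
    then show ?thesis
    proof cases
      case 1
      have "w = v" if w: "(u, w) \<in> parcs G" "subdiv_point k u w 1 \<in> X" for w
      proof -
        have "(u, w) \<in> A \<or> (w, u) \<in> A" using w(1) A by (auto simp: orientation_def)
        then show ?thesis
        proof
          assume "(u, w) \<in> A"
          then have "((u, w), 1) \<in> I" using mem[of u w 1] w(2) k by simp
          then have "(u, w) \<in> F" by (auto simp: I_def B_def)
          then show ?thesis using F(3) 1(2) by (auto dest: single_valuedD)
        next
          \<comment> \<open>On an edge oriented into \<open>u\<close>, the neighbour of
            \<open>u\<close> has position \<open>k\<close>, whose residue 3 keeps it out of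
            \<open>X\<close>.\<close>
          assume wu: "(w, u) \<in> A"
          have "subdiv_point k u w 1 = subdiv_point k w u k"
            using subdiv_point_reverse[of 1 k w u] by simp
          then have "((w, u), k) \<in> I" using mem[OF wu, of k] w(2) k by simp
          moreover have "k mod 4 = 3" "k \<noteq> 1" using k by simp_all
          ultimately show ?thesis by (auto simp: I_def B_def)
        qed
      qed
      moreover have nbhd: "open_nbhd ?H (Inl u) = {subdiv_point k u w 1 | w. (u, w) \<in> parcs G}"
        using k by (intro open_nbhd_Inl) simp
      moreover have xv: "x = subdiv_point k u v 1" using i(2) 1(1) by simp
      ultimately have "open_nbhd ?H (Inl u) \<inter> X \<subseteq> {x}" by auto
      moreover have "x \<in> open_nbhd ?H (Inl u)" unfolding nbhd xv using uv(2) by auto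
      ultimately have "open_nbhd ?H (Inl u) \<inter> X = {x}" using x by fast
      moreover have "Inl u \<in> pverts ?H"
        using in_arcsD1[OF uv(2)] by (simp add: k_subdivision_def)
      ultimately show ?thesis using Inl by blast
    next
      case 2
      have "k mod 4 = 3" using k by simp
      then have i': "i + 1 \<in> {1..k}" using ik 2 by (cases "i = k") auto
      have "(i + 1) mod 4 = 3" "(i + 2) mod 4 = 0" using 2 by presburger+
      then have "subdiv_point k u v (i + 1) \<notin> X" "i + 2 \<le> k \<Longrightarrow> subdiv_point k u v (i + 2) \<notin> X"
        using mem[OF uv(1)] i' ik by (auto simp: I_def B_def)
      \<comment> \<open>If \<open>i + 1 = k\<close>, the far neighbour is the original vertex
        \<open>v\<close>, which is never in \<open>X\<close>.\<close>
      moreover have "i + 2 \<le> k \<or> i + 2 = Suc k" using i' by auto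
      ultimately have "subdiv_point k u v (i + 1) \<notin> X" "subdiv_point k u v (i + 2) \<notin> X"
        using Inl[of v] by auto
      then show ?thesis
        using open_nbhd_inner[OF uv(2) i'] x i(2) inH[OF uv(1) i']
        by (intro bexI[of _ "subdiv_point k u v (i + 1)"]) auto
    next
      case 3
      have "i = 4 * (i div 4) + 1" using 3(1) by presburger
      \<comment> \<open>Position 1 being excluded, \<open>i\<close> is at least 5, so
        \<open>i - 2\<close> is still an inner position, different from 1.\<close>
      then obtain j where j: "i = 4 * j + 5" using 3(2) by (cases "i div 4") auto
      then have "i \<ge> 5" by simp
      then have i': "i - 1 \<in> {1..k}" "i - 2 \<in> {1..k}" using ik by auto
      have "(i - 1) mod 4 = 0" "(i - 2) mod 4 = 3" "i - 2 \<noteq> 1" by (simp_all add: j)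
      then have "subdiv_point k u v (i - 1) \<notin> X" "subdiv_point k u v (i - 2) \<notin> X"
        using mem[OF uv(1)] i' \<open>i \<ge> 5\<close> by (auto simp: I_def B_def)
      moreover have "i - 1 - 1 = i - 2" "i - 1 + 1 = i" using \<open>i \<ge> 5\<close> by simp_all
      ultimately show ?thesis
        using open_nbhd_inner[OF uv(2) i'(1)] x i(2) inH[OF uv(1) i'(1)]
        by (intro bexI[of _ "subdiv_point k u v (i - 1)"]) auto
    qed
  qed
  then have "super_dominating_set ?H (pverts ?H - X)"
    by (rule H.super_dominating_setI[OF XH])
  then have "super_domination_number ?H \<le> card (pverts ?H - X)"
    by (rule super_domination_number_attained(2)[OF H.pair_finite_verts])
  moreover have "card (pverts ?H - X) = card (pverts ?H) - card X" "card X \<le> card (pverts ?H)"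
    using finite_subset[OF XH H.pair_finite_verts] XH
    by (auto simp: card_Diff_subset intro: card_mono H.pair_finite_verts)
  ultimately show ?thesis using cardX card_verts_k_subdivision[of k] by simp
qed

section \<open>Selecting arcs in connected graphs, along cycles and in trees\<close>

lemma rtrancl_parcs_if_connected:
  assumes "Digraph_Component.connected (with_proj G)" "u \<in> pverts G" "v \<in> pverts G"
  shows "(u, v) \<in> (parcs G)\<^sup>*"
proof -
  have "u \<rightarrow>\<^sup>*\<^bsub>with_proj (mk_symmetric (with_proj G))\<^esub> v"
    using assms by (auto simp: Digraph_Component.connected_def strongly_connected_def)
  then have "u \<rightarrow>\<^sup>*\<^bsub>with_proj G\<^esub> v"
    using reachable_mk_symmetric_eq[OF pair_sym_arcs] by simp
  then show ?thesis using reachable_rtranclI by fastforce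
qed

text \<open>Take a maximal vertex set \<open>A\<close> around \<open>C\<close> that admits such an
  \<open>F\<close>. If a vertex were missing, a walk from it to \<open>C\<close> would contain an
  arc entering \<open>A\<close>, and adding that arc would enlarge \<open>A\<close>. For
  \<open>C\<close> a root this directs a spanning tree towards it; for \<open>C\<close> the vertices
  of a cycle it gives every vertex an outgoing arc.\<close>

lemma connected_functional_extension:
  assumes conn: "Digraph_Component.connected (with_proj G)"
    and C: "C \<subseteq> pverts G" "C \<noteq> {}"
    and F0: "F0 \<subseteq> parcs G" "F0 \<subseteq> C \<times> C" "single_valued F0" "F0 \<inter> F0\<inverse> = {}"
  obtains F where "F \<subseteq> parcs G" "single_valued F" "F \<inter> F\<inverse> = {}"
    "Domain F = Domain F0 \<union> (pverts G - C)" "\<And>u. u \<in> pverts G \<Longrightarrow> \<exists>c \<in> C. (u, c) \<in> F\<^sup>*"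
proof -
  \<comment> \<open>Requiring \<open>F \<subseteq> A \<times> A\<close> means that a new vertex
    meets no arc of \<open>F\<close>, so its new arc creates neither a second successor nor an
    opposite pair.\<close>
  define Q where "Q A F \<longleftrightarrow> F \<subseteq> parcs G \<and> F \<subseteq> A \<times> A \<and> single_valued F \<and> F \<inter> F\<inverse> = {} \<and>
    Domain F = Domain F0 \<union> (A - C) \<and> (\<forall>u \<in> A. \<exists>c \<in> C. (u, c) \<in> F\<^sup>*)" for A F
  define M where "M = {A. C \<subseteq> A \<and> A \<subseteq> pverts G \<and> (\<exists>F. Q A F)}"
  have "Q C F0" using F0 by (auto simp: Q_def)
  then have "C \<in> M" using C by (auto simp: M_def)
  moreover have "finite M"
    by (rule finite_subset[of _ "Pow (pverts G)"]) (auto simp: M_def pair_finite_verts)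
  ultimately obtain A where A: "A \<in> M" and max: "\<And>A'. A' \<in> M \<Longrightarrow> A \<subseteq> A' \<Longrightarrow> A = A'"
    using finite_has_maximal[of M] by blast
  obtain F where Q: "Q A F" using A by (auto simp: M_def)
  have CA: "C \<subseteq> A" "A \<subseteq> pverts G" using A by (auto simp: M_def)
  have "A = pverts G"
  proof (rule ccontr)
    assume "A \<noteq> pverts G"
    then obtain v where v: "v \<in> pverts G" "v \<notin> A" using CA by blast
    obtain c where c: "c \<in> C" using C by blast
    have "(v, c) \<in> (parcs G)\<^sup>*" using rtrancl_parcs_if_connected[OF conn v(1)] c C by blast
    then have "v \<notin> A \<Longrightarrow> \<exists>a b. (a, b) \<in> parcs G \<and> a \<notin> A \<and> b \<in> A"
      by (induction rule: converse_rtrancl_induct) (use c CA in auto)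
    then obtain a b where ab: "(a, b) \<in> parcs G" "a \<notin> A" "b \<in> A" using v by blast
    let ?F = "insert (a, b) F"
    have FA: "F \<subseteq> A \<times> A" using Q by (simp add: Q_def)
    have mono: "F\<^sup>* \<subseteq> ?F\<^sup>*" by (rule rtrancl_mono) auto
    have "Q (insert a A) ?F"
      unfolding Q_def
    proof (intro conjI ballI)
      show "?F \<subseteq> parcs G" using ab Q by (auto simp: Q_def)
      show "?F \<subseteq> insert a A \<times> insert a A" using ab FA by auto
      show "single_valued ?F" using Q FA ab by (auto simp: Q_def single_valued_def)
      show "?F \<inter> ?F\<inverse> = {}" using Q FA ab by (auto simp: Q_def)
      show "Domain ?F = Domain F0 \<union> (insert a A - C)" using Q ab CA by (auto simp: Q_def)
      fix u assume u: "u \<in> insert a A"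
      have *: "\<exists>c \<in> C. (w, c) \<in> ?F\<^sup>*" if "w \<in> A" for w
        using Q that mono unfolding Q_def by (meson subsetD)
      then obtain c where "c \<in> C" "(b, c) \<in> ?F\<^sup>*" using ab by blast
      then have "(a, c) \<in> ?F\<^sup>*" by (meson converse_rtrancl_into_rtrancl insertI1)
      then show "\<exists>c \<in> C. (u, c) \<in> ?F\<^sup>*" using u * \<open>c \<in> C\<close> by blast
    qed
    then have "insert a A \<in> M" using CA ab in_arcsD1[OF ab(1)] by (auto simp: M_def)
    then show False using max[of "insert a A"] ab by blast
  qed
  with Q show ?thesis by (intro that[of F]) (auto simp: Q_def)
qed

text \<open>The heads are distinct and form the same multiset as the tails, so tails are distinct
  too. Opposite arcs would each be the cyclic successor of the other, impossible for length at least
  3.\<close>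

lemma cycle_arcs_functional:
  assumes "pre_digraph.cycle (with_proj G) p" "3 \<le> length p"
  shows "set p \<subseteq> parcs G" "single_valued (set p)" "set p \<inter> (set p)\<inverse> = {}"
    "Range (set p) \<subseteq> Domain (set p)"
proof -
  from assms(1) obtain u where u: "awalk u p u" "distinct (tl (pawalk_verts u p))"
    by (auto simp: cycle_def)
  show "set p \<subseteq> parcs G" using u(1) by (auto simp: awalk_def)
  have "pcas u p u" using u(1) by (simp add: awalk_def)
  have tl: "tl (pawalk_verts w q) = map snd q" if "pcas w q v" for w q v
    using that
  proof (induction q arbitrary: w)
    case (Cons e q)
    then show ?case by (cases q) auto
  qed simp
  \<comment> \<open>Both sides list the vertices of the walk; for a closed walk, cancelling
    \<open>u\<close> equates the multisets of heads and tails.\<close>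
  have shift: "w # map snd q = map fst q @ [v]" if "pcas w q v" for w q v
    using that by (induction q arbitrary: w) auto
  have snd: "distinct (map snd p)" using tl[OF \<open>pcas u p u\<close>] u(2) by simp
  have eq: "u # map snd p = map fst p @ [u]" by (rule shift[OF \<open>pcas u p u\<close>])
  then have "mset (u # map snd p) = mset (map fst p @ [u])" by (rule arg_cong)
  then have mset: "mset (map snd p) = mset (map fst p)" by simp
  then have fst: "distinct (map fst p)" using snd mset_eq_imp_distinct_iff by blast
  show sv: "single_valued (set p)"
    using eq_key_imp_eq_value[OF fst] by (auto simp: single_valued_def)
  have "set (map snd p) = set (map fst p)" using mset by (rule mset_eq_setD)
  then show "Range (set p) \<subseteq> Domain (set p)" by (simp add: Range_snd Domain_fst)
  let ?l = "length p"
  have next_arc: "snd (p ! i) = fst (p ! (Suc i mod ?l))" if "i < ?l" for i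
  proof (cases "Suc i < ?l")
    case True
    then show ?thesis using arg_cong[OF eq, of "\<lambda>xs. xs ! Suc i"] that by (simp add: nth_append)
  next
    case False
    then have l: "Suc i = ?l" using that by simp
    moreover have "0 < ?l" using that by linarith
    ultimately show ?thesis
      using arg_cong[OF eq, of "\<lambda>xs. xs ! Suc i"] arg_cong[OF eq, of "\<lambda>xs. xs ! 0"] that
      by (simp add: nth_append flip: l)
  qed
  have fst_inj: "i = j" if "fst (p ! i) = fst (p ! j)" "i < ?l" "j < ?l" for i j
    using that nth_eq_iff_index_eq[OF fst, of i j] by simp
  have "(y, x) \<notin> set p" if xy: "(x, y) \<in> set p" for x y
  proof
    assume "(y, x) \<in> set p"
    then obtain i j where ij: "i < ?l" "j < ?l" "p ! i = (x, y)" "p ! j = (y, x)"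
      using xy by (metis in_set_conv_nth)
    then have "j = Suc i mod ?l" "i = Suc j mod ?l"
      using next_arc fst_inj by (metis fst_conv snd_conv mod_less_divisor length_pos_if_in_set xy)+
    then show False using assms(2) ij(1,2) by (auto simp: mod_Suc split: if_splits)
  qed
  then show "set p \<inter> (set p)\<inverse> = {}" by auto
qed

lemma card_single_valued:
  assumes "single_valued F"
  shows "card F = card (Domain F)"
proof -
  have "inj_on fst F" using assms by (auto simp: inj_on_def single_valued_def)
  then show ?thesis by (simp add: Domain_fst card_image)
qed

text \<open>The arcs of \<open>F\<close> connect all vertices through \<open>r\<close>, so an edge
  outside \<open>F \<union> F\<inverse>\<close> would close a path between its ends to a
  cycle.\<close>

lemma orientation_spanning_tree:
  assumes no_cycle: "\<not> (\<exists>p. pre_digraph.cycle (with_proj G) p \<and> 3 \<le> length p)"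
    and F: "F \<subseteq> parcs G" "F \<inter> F\<inverse> = {}"
    and reach: "\<And>u. u \<in> pverts G \<Longrightarrow> (u, r) \<in> F\<^sup>*"
  shows "orientation (parcs G) F"
proof -
  let ?T = "\<lparr> pverts = pverts G, parcs = F \<union> F\<inverse> \<rparr>"
  have TE: "F \<union> F\<inverse> \<subseteq> parcs G" using F(1) arcs_symmetric by auto
  interpret T: pair_wf_digraph ?T
    by unfold_locales (use TE wellformed' in auto)
  have "(a, b) \<in> F \<union> F\<inverse>" if ab: "(a, b) \<in> parcs G" for a b
  proof (rule ccontr)
    assume not: "(a, b) \<notin> F \<union> F\<inverse>"
    have V: "a \<in> pverts G" "b \<in> pverts G" using in_arcsD1[OF ab] in_arcsD2[OF ab] .
    have "(b, r) \<in> (F \<union> F\<inverse>)\<^sup>*" using reach[OF V(2)] by (meson Un_upper1 rtrancl_mono subsetD)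
    moreover have "(r, a) \<in> (F\<inverse>)\<^sup>*" using reach[OF V(1)] by (simp add: rtrancl_converse)
    then have "(r, a) \<in> (F \<union> F\<inverse>)\<^sup>*" by (meson Un_upper2 rtrancl_mono subsetD)
    ultimately have "(b, a) \<in> (F \<union> F\<inverse>)\<^sup>*" by (rule rtrancl_trans)
    then have "b \<rightarrow>\<^sup>*\<^bsub>with_proj ?T\<^esub> a"
      using T.reachable_conv'[of b a] V by simp
    then obtain p where p: "T.apath b p a" using T.reachable_apath by blast
    then have walk: "set p \<subseteq> F \<union> F\<inverse>" "pcas b p a" "distinct (pawalk_verts b p)"
      by (auto simp: T.apath_def T.awalk_def)
    \<comment> \<open>Dropping the first vertex \<open>a\<close> of this closed walk leaves exactly
      the vertex list of the path \<open>p\<close>, which is distinct.\<close>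
    have "cycle ((a, b) # p)"
      unfolding cycle_def awalk_def using walk ab V TE by (intro exI[of _ a]) auto
    \<comment> \<open>An empty path would make \<open>(a, b)\<close> a loop; a path of one arc would
      put \<open>(b, a)\<close> into \<open>F \<union> F\<inverse>\<close>.\<close>
    moreover have "2 \<le> length p"
    proof (rule ccontr)
      assume "\<not> 2 \<le> length p"
      then consider "p = []" | e where "p = [e]" by (cases p; cases "tl p") auto
      then show False
        using walk(1,2) no_loops'[OF ab] not by cases auto
    qed
    ultimately show False using no_cycle by (metis One_nat_def Suc_le_mono length_Cons numeral_3_eq_3 numeral_2_eq_2)
  qed
  then show ?thesis using TE F(2) by (auto simp only: orientation_def)
qed

end

section \<open>Combination of the bounds for trees and for graphs with a cycle\<close>

theorem theorem5p2:
  fixes G :: "'a pair_pre_digraph" and k :: nat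
  assumes "pair_graph G" and "Digraph_Component.connected (with_proj G)"
    and "k > 0" and "k mod 4 = 3"
  shows "real (super_domination_number (k_subdivision k G)) =
    (if undirected_tree G then (real k + 1) / 2 * real (num_edges G) + 1
     else (real k + 1) / 2 * real (num_edges G))"
proof -
  interpret pair_graph G by fact
  define t where "t = k div 4"
  have k: "k = 4 * t + 3" using assms(4) by (simp add: t_def) presburger
  let ?H = "k_subdivision k G" and ?m = "num_edges G" and ?n = "card (pverts G)"
  let ?\<gamma> = "super_domination_number ?H"
  obtain D where D: "super_dominating_set ?H D" "card D = ?\<gamma>"
    using super_domination_number_attained(1)[OF finite_verts_k_subdivision] by blast
  have half: "(real k + 1) / 2 * real ?m = real ((2 * t + 2) * ?m)" by (simp add: k algebra_simps)
  show ?thesis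
  proof (cases "undirected_tree G")
    case True
    then have no_cycle: "\<not> (\<exists>p. pre_digraph.cycle (with_proj G) p \<and> 3 \<le> length p)"
      by (simp add: undirected_tree_def)
    obtain r where r: "r \<in> pverts G"
      using assms(2) by (auto simp: Digraph_Component.connected_def strongly_connected_def)
    obtain F where F: "F \<subseteq> parcs G" "single_valued F" "F \<inter> F\<inverse> = {}"
      "Domain F = pverts G - {r}" "\<And>u. u \<in> pverts G \<Longrightarrow> (u, r) \<in> F\<^sup>*"
      using connected_functional_extension[OF assms(2), of "{r}" "{}"] r by auto
    have "orientation (parcs G) F" by (rule orientation_spanning_tree[OF no_cycle F(1,3,5)])
    then have "?m = card F" by (rule card_orientation)
    also have "card F = ?n - 1"
      using card_single_valued[OF F(2)] F(4) r pair_finite_verts by simp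
    finally have m: "?m = ?n - 1" "card F = ?m" by (simp_all add: \<open>?m = card F\<close>)
    have "?n > 0" using r pair_finite_verts by (auto simp: card_gt_0_iff)
    with m have n: "?n = ?m + 1" by simp
    have "?n + k * ?m \<le> 2 * ?\<gamma>"
      using card_verts_le_twice_super_dominating[OF finite_verts_k_subdivision D(1)] D(2)
        card_verts_k_subdivision[of k] by simp
    \<comment> \<open>Here \<open>?n + k * ?m\<close> equals \<open>(4 * t + 4) * ?m + 1\<close>,
      which is odd, so halving rounds up and gives the extra 1.\<close>
    then have "(2 * t + 2) * ?m + 1 \<le> ?\<gamma>" using n by (simp add: k algebra_simps)
    moreover have "?\<gamma> \<le> (2 * t + 2) * ?m + 1"
      using super_domination_number_k_subdivision_le[OF k F(1,3,2)] m(2) n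
      by (simp add: k algebra_simps)
    ultimately show ?thesis using True half by simp
  next
    case False
    then obtain p where p: "pre_digraph.cycle (with_proj G) p" "3 \<le> length p"
      using assms(2) by (auto simp: undirected_tree_def)
    note c = cycle_arcs_functional[OF p]
    have "Domain (set p) \<subseteq> pverts G" using c(1) in_arcsD1 by auto
    moreover have "Domain (set p) \<noteq> {}" using p(2) by (cases p) auto
    moreover have "set p \<subseteq> Domain (set p) \<times> Domain (set p)" using c(4) by auto
    ultimately obtain F where F: "F \<subseteq> parcs G" "single_valued F" "F \<inter> F\<inverse> = {}"
      "Domain F = Domain (set p) \<union> (pverts G - Domain (set p))"
      using connected_functional_extension[OF assms(2), of "Domain (set p)" "set p"] c(1-3) by metis
    \<comment> \<open>Every vertex, on the cycle or off it, is the tail of exactly one arc of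
      \<open>F\<close>.\<close>
    have "card F = ?n"
      using card_single_valued[OF F(2)] F(4) \<open>Domain (set p) \<subseteq> pverts G\<close>
      by (simp add: Un_absorb1)
    then have "?\<gamma> \<le> (2 * t + 2) * ?m"
      using super_domination_number_k_subdivision_le[OF k F(1,3,2)] by (simp add: k algebra_simps)
    moreover have "(2 * t + 2) * ?m \<le> ?\<gamma>"
      using super_dominating_set_k_subdivision_ge[of k "2 * t + 1" D] D by (simp add: k)
    ultimately show ?thesis using False half by simp
  qed
qed

end
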